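(* Let $\mathbb K$ be an algebraically closed field of characteristic $0$, let $d\ge1$, and let $l_1,\dots,l_{2d+1}$ be distinct (pairwise non-proportional) nonzero linear forms in $\mathbb K[x_0,x_1,x_2]$. Then $$\dim_{\mathbb K}(l_1^d,\dots,l_{2d+1}^d)_d<2d+1$$ if and only if in the set $Z=\{l_1^\vee,\dots,l_{2d+1}^\vee\}\subset(\mathbb P^2)^*$ there are at least $d+2$ aligned points.
   Context: $(l_1^d,\dots,l_{2d+1}^d)_d$ denotes the degree $d$ homogeneous component of the ideal generated by these powers, i.e. the linear span of $l_1^d,\dots,l_{2d+1}^d$. For $l=a_0x_0+a_1x_1+a_2x_2\neq0$, $l^\vee=(a_0:a_1:a_2)$ is the dual point in the dual projective plane. Aligned points are points lying on a common line. *)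

theory Defs
  imports "HOL-Analysis.Analysis" "HOL-Computational_Algebra.Polynomial" "HOL-Library.Poly_Mapping"
begin

text \<open>
  The ring of polynomials in \<open>x\<^sub>0, x\<^sub>1, x\<^sub>2\<close> with coefficients in \<open>'a\<close>. The variables are
  indexed by the three-element type \<open>3\<close> with elements \<open>0, 1, 2\<close>; a monomial is its exponent
  vector \<open>3 \<Rightarrow>\<^sub>0 nat\<close>, and multiplication is the convolution product of \<open>Poly_Mapping\<close>.
\<close>

type_synonym 'a mpoly3 = "(3 \<Rightarrow>\<^sub>0 nat) \<Rightarrow>\<^sub>0 'a"

definition mpoly_scale :: "'a::comm_ring_1 \<Rightarrow> 'a mpoly3 \<Rightarrow> 'a mpoly3"
  where "mpoly_scale c p = Poly_Mapping.single 0 c * p"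

global_interpretation mpoly3: vector_space "mpoly_scale :: 'a::field \<Rightarrow> 'a mpoly3 \<Rightarrow> 'a mpoly3"
  defines mpoly_dim = mpoly3.dim
  by unfold_locales
     (simp_all add: mpoly_scale_def distrib_left distrib_right single_add mult_single
        flip: mult.assoc single_one)

text \<open>Ideals are the submodules of the ring regarded as a module over itself.\<close>

global_interpretation ideal: module "(*) :: 'a::comm_ring_1 \<Rightarrow> 'a \<Rightarrow> 'a"
  defines ideal_generated = ideal.span
  by unfold_locales (simp_all add: algebra_simps)

definition homogeneous :: "nat \<Rightarrow> 'a::zero mpoly3 \<Rightarrow> bool"
  where "homogeneous d p \<longleftrightarrow>
    (\<forall>m \<in> Poly_Mapping.keys p. (\<Sum>i\<in>UNIV. Poly_Mapping.lookup m i) = d)"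

definition homogeneous_component :: "nat \<Rightarrow> 'a::zero mpoly3 set \<Rightarrow> 'a mpoly3 set"
  where "homogeneous_component d I = {p \<in> I. homogeneous d p}"

text \<open>
  A point of the projective plane is the set of all nonzero multiples of a nonzero vector.
  A line consists of the points orthogonal to a fixed nonzero vector under the bilinear
  form \<open>\<Sum>\<^sub>i b\<^sub>i v\<^sub>i\<close>.
\<close>

definition proj_point :: "'a::field ^ 3 \<Rightarrow> ('a ^ 3) set"
  where "proj_point v = {c *s v |c. c \<noteq> 0}"

definition proj_line :: "'a::field ^ 3 \<Rightarrow> ('a ^ 3) set set"
  where "proj_line b = {proj_point v |v. v \<noteq> 0 \<and> (\<Sum>i\<in>UNIV. b $ i * v $ i) = 0}"

definition aligned :: "('a::field ^ 3) set set \<Rightarrow> bool"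
  where "aligned S \<longleftrightarrow> (\<exists>b. b \<noteq> 0 \<and> S \<subseteq> proj_line b)"

text \<open>
  The coefficient of \<open>x\<^sub>i\<close> is the one at the exponent vector \<open>Poly_Mapping.single i 1\<close>.
\<close>

definition dual_point :: "'a::field mpoly3 \<Rightarrow> ('a ^ 3) set"
  where "dual_point l = proj_point (\<chi> i. Poly_Mapping.lookup l (Poly_Mapping.single i 1))"

end

theory Submission
  imports Defs
begin

text \<open>
  A relation \<open>\<Sum>\<^sub>i c\<^sub>i l\<^sub>i\<^sup>d = 0\<close> polarises to \<open>\<Sum>\<^sub>i c\<^sub>i F(v\<^sub>i) = 0\<close> for every product \<open>F\<close> of
  \<open>d\<close> linear forms, where \<open>v\<^sub>i\<close> is the coefficient vector of \<open>l\<^sub>i\<close>. If no \<open>d + 2\<close> of the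
  points are aligned, then for each point \<open>p\<close> every line through \<open>p\<close> contains at most \<open>d\<close>
  of the other \<open>2d\<close> points. These can therefore be split into \<open>d\<close> pairs such that no pair is
  aligned with \<open>p\<close>. The product of the \<open>d\<close> joining lines vanishes at all points but \<open>p\<close>, so
  the coefficient of \<open>p\<close> in the relation is zero. Conversely, linear forms with aligned dual
  points lie in the span of two forms \<open>P, Q\<close>, and their \<open>d\<close>-th powers in the span of the
  \<open>d + 1\<close> products \<open>P\<^sup>kQ\<^bsup>d - k\<^esup>\<close>.
\<close>

text \<open>The interpretation of rings as modules over themselves turns reassociation to the left
  into a simplification rule, which loops together with \<open>algebra_simps\<close>.\<close>

declare ideal.scale_scale [simp del]

section \<open>Vectors in three-space\<close>

text \<open>A zero value means that the point \<open>v\<close> lies on the line \<open>b\<close>.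
  The same number is the value of the linear form with coefficients \<open>b\<close> at the vector
  \<open>v\<close>.\<close>

definition dot :: "'a::field ^ 3 \<Rightarrow> 'a ^ 3 \<Rightarrow> 'a"
  where "dot b v = (\<Sum>i\<in>UNIV. b $ i * v $ i)"

text \<open>In the type \<open>3\<close> the numeral \<open>3\<close> is the element
  \<open>0\<close>, so all coordinates occur. For non-proportional \<open>v\<close> and
  \<open>w\<close> this is the line joining the two points.\<close>

definition cross :: "'a::field ^ 3 \<Rightarrow> 'a ^ 3 \<Rightarrow> 'a ^ 3"
  where "cross v w = vector [v $ 2 * w $ 3 - v $ 3 * w $ 2,
                             v $ 3 * w $ 1 - v $ 1 * w $ 3,
                             v $ 1 * w $ 2 - v $ 2 * w $ 1]"

lemma dot_commute: "dot v w = dot w v"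
  by (simp add: dot_def mult.commute)

lemma dot_add_right: "dot v (x + y) = dot v x + dot v y"
  by (simp add: dot_def sum.distrib algebra_simps)

lemma dot_scale_right: "dot v (c *s x) = c * dot v x"
  by (simp add: dot_def sum_distrib_left algebra_simps)

lemma dot_cross: "dot (cross v w) v = 0" "dot (cross v w) w = 0"
  by (simp_all add: dot_def cross_def sum_3 algebra_simps)

text \<open>The vanishing minors give \<open>v $ i * w $ k = v $ k * w $ i\<close> for all
  \<open>i\<close>; a coordinate \<open>k\<close> with \<open>w $ k\<close> nonzero can be divided
  out.\<close>

lemma cross_eq_0_imp_scale:
  assumes "cross v w = 0" "w \<noteq> 0"
  obtains c where "v = c *s w"
proof -
  have e: "v $ 2 * w $ 3 = v $ 3 * w $ 2" "v $ 3 * w $ 1 = v $ 1 * w $ 3"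
    "v $ 1 * w $ 2 = v $ 2 * w $ 1"
    using assms(1) by (simp_all add: cross_def vec_eq_iff forall_3)
  obtain k where k: "w $ k \<noteq> 0"
    using assms(2) by (auto simp: vec_eq_iff)
  have "v $ i * w $ k = v $ k * w $ i" for i
    using e exhaust_3[of i] exhaust_3[of k] by (auto simp: algebra_simps)
  then have "v = (v $ k / w $ k) *s w"
    using k by (simp add: vec_eq_iff field_simps)
  then show thesis by (rule that)
qed

text \<open>The joins of \<open>p\<close> with \<open>v\<close> and with \<open>w\<close> both
  contain \<open>p\<close>, so they meet in a multiple of \<open>p\<close>; the factor is the
  determinant of the three vectors. If the line joining \<open>v\<close> and \<open>w\<close> passes
  through \<open>p\<close>, the two joins are therefore linearly dependent.\<close>

lemma cross_cross_common:
  "cross (cross p v) (cross p w) = dot (cross v w) p *s p"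
  by (simp add: vec_eq_iff forall_3 cross_def dot_def sum_3 algebra_simps)

text \<open>The equation is solved for a coordinate at which \<open>b\<close> is nonzero. This
  supplies the two forms that generate all linear forms with dual point on one line.\<close>

lemma orthogonal_two_generators:
  fixes b :: "'a::field ^ 3"
  assumes "b \<noteq> 0"
  obtains w1 w2 where "\<And>v. dot b v = 0 \<Longrightarrow> \<exists>s t. v = s *s w1 + t *s w2"
proof -
  obtain k where k: "b $ k \<noteq> 0"
    using assms by (auto simp: vec_eq_iff)
  consider "b $ 1 \<noteq> 0" | "b $ 2 \<noteq> 0" | "b $ 3 \<noteq> 0"
    using k exhaust_3[of k] by auto
  then show thesis
  proof cases
    case 1
    show ?thesis
    proof (rule that[of "vector [- b $ 2 / b $ 1, 1, 0]" "vector [- b $ 3 / b $ 1, 0, 1]"])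
      fix v assume "dot b v = 0"
      then have "v = (v $ 2) *s vector [- b $ 2 / b $ 1, 1, 0]
          + (v $ 3) *s vector [- b $ 3 / b $ 1, 0, 1]"
        using 1 by (simp add: vec_eq_iff forall_3 dot_def sum_3 field_simps)
            (simp add: eq_neg_iff_add_eq_0 algebra_simps)
      then show "\<exists>s t. v = s *s vector [- b $ 2 / b $ 1, 1, 0]
          + t *s vector [- b $ 3 / b $ 1, 0, 1]" by blast
    qed
  next
    case 2
    show ?thesis
    proof (rule that[of "vector [1, - b $ 1 / b $ 2, 0]" "vector [0, - b $ 3 / b $ 2, 1]"])
      fix v assume "dot b v = 0"
      then have "v = (v $ 1) *s vector [1, - b $ 1 / b $ 2, 0]
          + (v $ 3) *s vector [0, - b $ 3 / b $ 2, 1]"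
        using 2 by (simp add: vec_eq_iff forall_3 dot_def sum_3 field_simps)
            (simp add: eq_neg_iff_add_eq_0 algebra_simps)
      then show "\<exists>s t. v = s *s vector [1, - b $ 1 / b $ 2, 0]
          + t *s vector [0, - b $ 3 / b $ 2, 1]" by blast
    qed
  next
    case 3
    show ?thesis
    proof (rule that[of "vector [1, 0, - b $ 1 / b $ 3]" "vector [0, 1, - b $ 2 / b $ 3]"])
      fix v assume "dot b v = 0"
      then have "v = (v $ 1) *s vector [1, 0, - b $ 1 / b $ 3]
          + (v $ 2) *s vector [0, 1, - b $ 2 / b $ 3]"
        using 3 by (simp add: vec_eq_iff forall_3 dot_def sum_3 field_simps)
            (simp add: eq_neg_iff_add_eq_0 algebra_simps)
      then show "\<exists>s t. v = s *s vector [1, 0, - b $ 1 / b $ 3]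
          + t *s vector [0, 1, - b $ 2 / b $ 3]" by blast
    qed
  qed
qed

section \<open>Projective points and incidence\<close>

lemma proj_point_eq_iff:
  fixes v w :: "'a::field ^ 3"
  shows "proj_point v = proj_point w \<longleftrightarrow> (\<exists>c. c \<noteq> 0 \<and> v = c *s w)"
proof
  assume "proj_point v = proj_point w"
  moreover have "v \<in> proj_point v"
    unfolding proj_point_def by (auto intro!: exI[of _ 1])
  ultimately show "\<exists>c. c \<noteq> 0 \<and> v = c *s w"
    unfolding proj_point_def by auto
next
  assume "\<exists>c. c \<noteq> 0 \<and> v = c *s w"
  then obtain c where c: "c \<noteq> 0" "v = c *s w" by blast
  show "proj_point v = proj_point w"
  proof (rule set_eqI)
    fix x
    have "x = a *s w \<Longrightarrow> x = (a / c) *s v" for a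
      using c by simp
    moreover have "x = a *s v \<Longrightarrow> x = (a * c) *s w" for a
      using c by simp
    ultimately show "x \<in> proj_point v \<longleftrightarrow> x \<in> proj_point w"
      unfolding proj_point_def mem_Collect_eq using c(1)
      by (metis divide_eq_0_iff mult_eq_0_iff)
  qed
qed

lemma proj_point_in_proj_line_iff:
  assumes "v \<noteq> 0"
  shows "proj_point v \<in> proj_line b \<longleftrightarrow> dot b v = 0"
proof
  assume "proj_point v \<in> proj_line b"
  then obtain w where "proj_point v = proj_point w" "dot b w = 0"
    unfolding proj_line_def mem_Collect_eq dot_def[symmetric] by blast
  then show "dot b v = 0" by (auto simp: proj_point_eq_iff dot_scale_right)
next
  assume "dot b v = 0"
  then show "proj_point v \<in> proj_line b"
    unfolding proj_line_def mem_Collect_eq dot_def[symmetric] using assms by blast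
qed

section \<open>Products of lines avoiding a point\<close>

text \<open>Sort \<open>A\<close> by \<open>f\<close> and pair the \<open>i\<close>-th element with the \<open>(i + d)\<close>-th: if both had
  the same value, so would all \<open>d + 1\<close> elements between them.\<close>

lemma pairing_of_distinct_values:
  fixes f :: "'b \<Rightarrow> 'c"
  assumes "finite A" "card A = 2 * d"
    and fibre: "\<And>y. card {x \<in> A. f x = y} \<le> d"
  obtains g h where "A = g ` {..<d} \<union> h ` {..<d}" "\<And>i. i < d \<Longrightarrow> f (g i) \<noteq> f (h i)"
proof -
  \<comment> \<open>The values carry no order; numbering them injectively by \<open>r\<close> makes
    sorting possible, and equal numbers still mean equal values.\<close>
  obtain r :: "'c \<Rightarrow> nat" where r: "inj_on r (f ` A)"
    using finite_imp_inj_to_nat_seg[of "f ` A"] assms(1) by auto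
  obtain ys where ys: "set ys = A" "distinct ys"
    using finite_distinct_list[OF assms(1)] by blast
  define xs where "xs = sort_key (r \<circ> f) ys"
  have xs: "set xs = A" "distinct xs" "sorted (map (r \<circ> f) xs)"
    unfolding xs_def using ys by simp_all
  have len: "length xs = 2 * d"
    using xs assms(2) distinct_card by metis
  show thesis
  proof (rule that[of "\<lambda>i. xs ! i" "\<lambda>i. xs ! (i + d)"])
    have "x \<in> (!) xs ` {..<d} \<union> (\<lambda>i. xs ! (i + d)) ` {..<d}" if x: "x \<in> A" for x
    proof -
      obtain i where i: "i < 2 * d" "x = xs ! i"
        using x xs(1) len by (metis in_set_conv_nth)
      show ?thesis
      proof (cases "i < d")
        case False
        then have "x = xs ! ((i - d) + d)" "i - d < d" using i by auto
        then show ?thesis by blast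
      qed (use i in blast)
    qed
    moreover have "xs ! i \<in> A" if "i < 2 * d" for i
      using that xs(1) len nth_mem by metis
    ultimately show "A = (!) xs ` {..<d} \<union> (\<lambda>i. xs ! (i + d)) ` {..<d}"
      by auto
  next
    fix i assume i: "i < d"
    show "f (xs ! i) \<noteq> f (xs ! (i + d))"
    proof
      assume eq: "f (xs ! i) = f (xs ! (i + d))"
      have inA: "xs ! j \<in> A" if "j < 2 * d" for j
        using that xs(1) len nth_mem by metis
      have *: "f (xs ! j) = f (xs ! i)" if j: "j \<in> {i..i + d}" for j
      proof -
        have "r (f (xs ! i)) \<le> r (f (xs ! j))" "r (f (xs ! j)) \<le> r (f (xs ! (i + d)))"
          using sorted_nth_mono[OF xs(3), of i j] sorted_nth_mono[OF xs(3), of j "i + d"] i j len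
          by auto
        then have "r (f (xs ! j)) = r (f (xs ! i))" using eq by simp
        then show ?thesis
          using r inA i j by (auto dest!: inj_onD)
      qed
      have "(!) xs ` {i..i + d} \<subseteq> {x \<in> A. f x = f (xs ! i)}"
      proof (intro image_subsetI CollectI conjI)
        fix j assume j: "j \<in> {i..i + d}"
        then show "xs ! j \<in> A" using inA i by simp
        show "f (xs ! j) = f (xs ! i)" using *[OF j] .
      qed
      then have "card ((!) xs ` {i..i + d}) \<le> d"
        using card_mono[of "{x \<in> A. f x = f (xs ! i)}" "(!) xs ` {i..i + d}"]
          assms(1) fibre[of "f (xs ! i)"] by simp
      moreover have "inj_on ((!) xs) {i..i + d}"
        using xs(2) i len by (auto intro!: inj_on_nth)
      ultimately show False by (simp add: card_image)
    qed
  qed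
qed

text \<open>Each point of \<open>A\<close> is labelled by its line through \<open>p\<close>, so at
  most \<open>d\<close> points share a label and differently labelled points can be paired. The join
  of a pair misses \<open>p\<close>, since otherwise both members would have the same label. A list
  keeps repeated joins, so there are exactly \<open>d\<close> factors.\<close>

lemma lines_avoiding_point:
  fixes v :: "'b \<Rightarrow> 'a::field ^ 3"
  assumes "finite A" "card A = 2 * d"
    and indep: "\<And>j. j \<in> A \<Longrightarrow> cross p (v j) \<noteq> 0"
    and lines: "\<And>b. b \<noteq> 0 \<Longrightarrow> dot b p = 0 \<Longrightarrow> card {j \<in> A. dot b (v j) = 0} \<le> d"
  obtains bs where "length bs = d" "\<And>b. b \<in> set bs \<Longrightarrow> dot b p \<noteq> 0"
    "\<And>j. j \<in> A \<Longrightarrow> \<exists>b \<in> set bs. dot b (v j) = 0"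
proof -
  define f where "f j = proj_point (cross p (v j))" for j
  have "card {j \<in> A. f j = y} \<le> d" for y
  proof (cases "{j \<in> A. f j = y} = {}")
    case False
    then obtain k where k: "k \<in> A" "f k = y" by blast
    \<comment> \<open>Equal labels mean proportional joins with \<open>p\<close>, so the join of
      \<open>p\<close> with \<open>v k\<close> also contains \<open>v j\<close>.\<close>
    have "{j \<in> A. f j = y} \<subseteq> {j \<in> A. dot (cross p (v k)) (v j) = 0}"
    proof clarify
      fix j assume "j \<in> A" "y = f j"
      then obtain c where "cross p (v k) = c *s cross p (v j)"
        using k unfolding f_def by (auto simp: proj_point_eq_iff)
      then show "dot (cross p (v k)) (v j) = 0"
        by (metis dot_commute dot_cross(2) dot_scale_right mult_zero_right)
    qed
    then show ?thesis
      using lines[OF indep[OF k(1)] dot_cross(1)] assms(1)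
        card_mono[of "{j \<in> A. dot (cross p (v k)) (v j) = 0}" "{j \<in> A. f j = y}"]
      by simp
  next
    case True
    then show ?thesis by (metis card.empty zero_le)
  qed
  then obtain g h where gh: "A = g ` {..<d} \<union> h ` {..<d}"
      "\<And>i. i < d \<Longrightarrow> f (g i) \<noteq> f (h i)"
    using pairing_of_distinct_values[OF assms(1,2)] by metis
  show thesis
  proof (rule that[of "map (\<lambda>i. cross (v (g i)) (v (h i))) [0..<d]"])
    fix b assume "b \<in> set (map (\<lambda>i. cross (v (g i)) (v (h i))) [0..<d])"
    then obtain i where i: "i < d" "b = cross (v (g i)) (v (h i))" by auto
    have A: "g i \<in> A" "h i \<in> A" using gh(1) i by auto
    show "dot b p \<noteq> 0"
    proof
      assume "dot b p = 0"
      then have "cross (cross p (v (g i))) (cross p (v (h i))) = 0"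
        using i by (simp add: cross_cross_common)
      then obtain c where c: "cross p (v (g i)) = c *s cross p (v (h i))"
        using cross_eq_0_imp_scale indep[OF A(2)] by blast
      moreover have "c \<noteq> 0" using c indep[OF A(1)] by auto
      ultimately show False
        using gh(2)[OF i(1)] unfolding f_def proj_point_eq_iff by blast
    qed
  next
    fix j assume "j \<in> A"
    then obtain i where "i < d" "j = g i \<or> j = h i" using gh(1) by auto
    then show "\<exists>b \<in> set (map (\<lambda>i. cross (v (g i)) (v (h i))) [0..<d]). dot b (v j) = 0"
      by (auto intro!: bexI[of _ i] simp: dot_cross)
  qed simp
qed

section \<open>Polarisation of relations between powers\<close>

text \<open>Differentiating in the direction \<open>g\<close> turns one factor of each power into
  \<open>dot g (v i)\<close>, up to the exponent, which is nonzero in characteristic 0. The new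
  factor is absorbed into \<open>c\<close>, hence the induction over arbitrary
  \<open>c\<close>.\<close>

lemma polarise_power_relation:
  fixes v :: "'b \<Rightarrow> 'a::field_char_0 ^ 3"
  assumes "\<And>x. (\<Sum>i\<in>I. c i * dot (v i) x ^ length bs) = 0"
  shows "(\<Sum>i\<in>I. c i * (\<Prod>b\<leftarrow>bs. dot b (v i))) = 0"
  using assms
proof (induction bs arbitrary: c)
  case (Cons g gs)
  let ?n = "length gs"
  have "(\<Sum>i\<in>I. (c i * dot g (v i)) * dot (v i) x ^ ?n) = 0" for x
  proof -
    \<comment> \<open>\<open>P\<close> is the relation restricted to the line of points
      \<open>x + t *s g\<close>, as a polynomial in \<open>t\<close>. It vanishes for every
      \<open>t\<close> in an infinite field, so it is zero.\<close>
    define P where "P = (\<Sum>i\<in>I. smult (c i) ([:dot (v i) x, dot (v i) g:] ^ Suc ?n))"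
    have "poly P t = 0" for t
      using Cons.prems[of "x + t *s g"]
      by (simp add: P_def poly_sum dot_add_right dot_scale_right del: power_Suc)
    then have "P = 0" by (simp add: poly_all_0_iff_0[symmetric])
    then have "poly (pderiv P) 0 = 0" by simp
    moreover have "poly (pderiv P) 0
        = of_nat (Suc ?n) * (\<Sum>i\<in>I. (c i * dot g (v i)) * dot (v i) x ^ ?n)"
      unfolding P_def higher_pderiv_sum[of 1, simplified]
      by (simp add: poly_sum pderiv_smult pderiv_power_Suc pderiv_pCons sum_distrib_left
          dot_commute[of g] mult_ac del: of_nat_Suc power_Suc)
    ultimately show ?thesis by (simp del: of_nat_Suc)
  qed
  from Cons.IH[OF this] show ?case by (simp add: mult.assoc)
qed simp

section \<open>Evaluation and linear forms\<close>

definition mpoly3_eval :: "'a::comm_ring_1 ^ 3 \<Rightarrow> 'a mpoly3 \<Rightarrow> 'a"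
  where "mpoly3_eval x p = (\<Sum>m\<in>Poly_Mapping.keys p. Poly_Mapping.lookup p m * (\<Prod>i\<in>UNIV. x $ i ^ Poly_Mapping.lookup m i))"

text \<open>Polynomials with different supports can thus be summed over a common index set.\<close>

lemma mpoly3_eval_superset:
  assumes "finite S" "Poly_Mapping.keys p \<subseteq> S"
  shows "mpoly3_eval x p = (\<Sum>m\<in>S. Poly_Mapping.lookup p m * (\<Prod>i\<in>UNIV. x $ i ^ Poly_Mapping.lookup m i))"
  unfolding mpoly3_eval_def using assms
  by (intro sum.mono_neutral_left) (auto simp: in_keys_iff)

lemma mpoly3_eval_add: "mpoly3_eval x (p + q) = mpoly3_eval x p + mpoly3_eval x q"
proof -
  let ?S = "Poly_Mapping.keys p \<union> Poly_Mapping.keys q"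
  have "Poly_Mapping.keys (p + q) \<subseteq> ?S" by (rule Poly_Mapping.keys_add)
  then show ?thesis
    using mpoly3_eval_superset[of ?S "p + q" x] mpoly3_eval_superset[of ?S p x]
      mpoly3_eval_superset[of ?S q x]
    by (simp add: lookup_add distrib_right sum.distrib)
qed

lemma mpoly3_eval_single:
  "mpoly3_eval x (Poly_Mapping.single m c) = c * (\<Prod>i\<in>UNIV. x $ i ^ Poly_Mapping.lookup m i)"
  using mpoly3_eval_superset[of "{m}" "Poly_Mapping.single m c" x] by simp

lemma mpoly3_eval_0 [simp]: "mpoly3_eval x 0 = 0"
  by (simp add: mpoly3_eval_def)

lemma mpoly3_eval_sum: "mpoly3_eval x (sum f I) = (\<Sum>i\<in>I. mpoly3_eval x (f i))"
  by (induction I rule: infinite_finite_induct) (simp_all add: mpoly3_eval_add)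

lemma mpoly3_induct [case_names single add]:
  fixes p :: "'a::comm_ring_1 mpoly3"
  assumes "\<And>m c. P (Poly_Mapping.single m c)" "\<And>p q. P p \<Longrightarrow> P q \<Longrightarrow> P (p + q)"
  shows "P p"
proof -
  have "P (\<Sum>m\<in>S. Poly_Mapping.single m (Poly_Mapping.lookup p m))" if "finite S" for S
    using that
  proof induction
    case empty
    \<comment> \<open>The zero polynomial counts as a monomial term with coefficient 0.\<close>
    show ?case using assms(1)[of 0 0] by simp
  qed (use assms in simp)
  moreover have "p = (\<Sum>m\<in>Poly_Mapping.keys p. Poly_Mapping.single m (Poly_Mapping.lookup p m))"
    by (rule poly_mapping_eqI) (simp add: lookup_sum lookup_single when_def in_keys_iff)
  ultimately show ?thesis using finite_keys by metis
qed

text \<open>Both sides are additive in each factor, so it suffices to compare them on monomial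
  terms.\<close>

lemma mpoly3_eval_mult: "mpoly3_eval x (p * q) = mpoly3_eval x p * mpoly3_eval x q"
proof (induction p rule: mpoly3_induct)
  case (single m c)
  show ?case
    by (induction q rule: mpoly3_induct)
      (simp_all add: mpoly3_eval_single mpoly3_eval_add mult_single lookup_add power_add
        prod.distrib algebra_simps)
qed (simp add: mpoly3_eval_add distrib_right)

lemma mpoly3_eval_scale: "mpoly3_eval x (mpoly_scale c p) = c * mpoly3_eval x p"
  by (simp add: mpoly_scale_def mpoly3_eval_mult mpoly3_eval_single)

lemma mpoly3_eval_power: "mpoly3_eval x (p ^ n) = mpoly3_eval x p ^ n"
proof (induction n)
  case 0
  show ?case using mpoly3_eval_single[of x 0 1] by simp
qed (simp add: mpoly3_eval_mult)

definition linear_form :: "'a::field ^ 3 \<Rightarrow> 'a mpoly3"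
  where "linear_form v = (\<Sum>i\<in>UNIV. Poly_Mapping.single (Poly_Mapping.single i 1) (v $ i))"

text \<open>This is the representative of \<open>dual_point l\<close>; it inverts
  \<open>linear_form\<close> on forms of degree 1.\<close>

definition coeff_vector :: "'a::field mpoly3 \<Rightarrow> 'a ^ 3"
  where "coeff_vector l = (\<chi> i. Poly_Mapping.lookup l (Poly_Mapping.single i 1))"

lemma degree_one_monomial:
  fixes m :: "3 \<Rightarrow>\<^sub>0 nat"
  assumes "(\<Sum>i\<in>UNIV. Poly_Mapping.lookup m i) = 1"
  obtains i where "m = Poly_Mapping.single i 1"
proof -
  obtain i where i: "Poly_Mapping.lookup m i = 1" "\<And>j. j \<noteq> i \<Longrightarrow> Poly_Mapping.lookup m j = 0"
    using assms sum_eq_1_iff[of UNIV "Poly_Mapping.lookup m"] by auto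
  have "m = Poly_Mapping.single i 1"
    by (rule poly_mapping_eqI) (use i in \<open>auto simp: lookup_single when_def\<close>)
  then show thesis by (rule that)
qed

lemma single_exponent_eq_iff:
  "Poly_Mapping.single i (1::nat) = Poly_Mapping.single j 1 \<longleftrightarrow> i = j"
  by (metis lookup_single_eq lookup_single_not_eq zero_neq_one)

lemma lookup_linear_form:
  "Poly_Mapping.lookup (linear_form v) (Poly_Mapping.single i 1) = v $ i"
  unfolding linear_form_def lookup_sum lookup_single single_exponent_eq_iff
  by (simp add: when_def)

lemma lookup_linear_form_other:
  assumes "\<And>i. m \<noteq> Poly_Mapping.single i 1"
  shows "Poly_Mapping.lookup (linear_form v) m = 0"
  unfolding linear_form_def lookup_sum lookup_single
  by (rule sum.neutral) (use assms[symmetric] in \<open>simp add: when_def del: One_nat_def\<close>)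

lemma homogeneous_1_eq_linear_form:
  assumes "homogeneous 1 l"
  shows "l = linear_form (coeff_vector l)"
proof (rule poly_mapping_eqI)
  fix m
  show "Poly_Mapping.lookup l m = Poly_Mapping.lookup (linear_form (coeff_vector l)) m"
  proof (cases "\<exists>i. m = Poly_Mapping.single i 1")
    case True
    then show ?thesis by (auto simp: lookup_linear_form coeff_vector_def simp del: One_nat_def)
  next
    case False
    have "m \<notin> Poly_Mapping.keys l"
      using assms False degree_one_monomial[of m] unfolding homogeneous_def by metis
    then show ?thesis
      using False lookup_linear_form_other[of m] by (simp add: in_keys_iff)
  qed
qed

lemma linear_form_scale: "linear_form (c *s v) = mpoly_scale c (linear_form v)"
  by (simp add: linear_form_def mpoly_scale_def sum_distrib_left mult_single)

lemma linear_form_add: "linear_form (v + w) = linear_form v + linear_form w"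
  by (simp add: linear_form_def single_add sum.distrib)

lemma linear_form_0 [simp]: "linear_form 0 = 0"
  by (simp add: linear_form_def)

lemma prod_power_indicator:
  fixes x :: "'a::comm_ring_1 ^ 3"
  shows "(\<Prod>j\<in>UNIV. x $ j ^ Poly_Mapping.lookup (Poly_Mapping.single i (1::nat)) j) = x $ i"
proof -
  have "x $ j ^ Poly_Mapping.lookup (Poly_Mapping.single i (1::nat)) j = (if j = i then x $ i else 1)" for j
    by (auto simp: lookup_single when_def)
  then show ?thesis by simp
qed

lemma mpoly3_eval_linear_form: "mpoly3_eval x (linear_form v) = dot v x"
  unfolding linear_form_def mpoly3_eval_sum mpoly3_eval_single prod_power_indicator dot_def ..

section \<open>The homogeneous component as a linear span\<close>

abbreviation total_degree :: "(3 \<Rightarrow>\<^sub>0 nat) \<Rightarrow> nat"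
  where "total_degree m \<equiv> (\<Sum>i\<in>UNIV. Poly_Mapping.lookup m i)"

lemma homogeneous_add:
  assumes "homogeneous d p" "homogeneous d q"
  shows "homogeneous d (p + q)"
  using assms Poly_Mapping.keys_add[of p q] unfolding homogeneous_def by blast

lemma homogeneous_mult:
  assumes "homogeneous m p" "homogeneous n q"
  shows "homogeneous (m + n) (p * q)"
  unfolding homogeneous_def
proof
  fix k assume "k \<in> Poly_Mapping.keys (p * q)"
  then obtain a b where "a \<in> Poly_Mapping.keys p" "b \<in> Poly_Mapping.keys q" "k = a + b"
    using keys_mult[of p q] by blast
  then show "total_degree k = m + n"
    using assms by (simp add: homogeneous_def lookup_add sum.distrib)
qed

lemma homogeneous_const: "homogeneous 0 (Poly_Mapping.single 0 c)"
  by (auto simp: homogeneous_def)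

lemma homogeneous_power:
  fixes p :: "'a::comm_ring_1 mpoly3"
  assumes "homogeneous m p"
  shows "homogeneous (n * m) (p ^ n)"
proof (induction n)
  case 0
  show ?case using homogeneous_const[of "1::'a"] by simp
next
  case (Suc n)
  then show ?case using homogeneous_mult[OF assms Suc] by simp
qed

lemma homogeneous_scale:
  assumes "homogeneous d p"
  shows "homogeneous d (mpoly_scale c p)"
  using homogeneous_mult[OF homogeneous_const assms] by (simp add: mpoly_scale_def)

lemma homogeneous_span:
  assumes "\<And>q. q \<in> B \<Longrightarrow> homogeneous d q" "p \<in> mpoly3.span B"
  shows "homogeneous d p"
  using assms(2)
proof (induction rule: mpoly3.span_induct_alt)
  case base
  show ?case by (simp add: homogeneous_def)
qed (simp add: assms(1) homogeneous_add homogeneous_scale)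

text \<open>Modulo terms of degree above \<open>d\<close>, a multiplier acts on forms of degree \<open>d\<close> through its
  constant term.\<close>

lemma ideal_eq_span_plus_higher:
  fixes B :: "'a::field mpoly3 set"
  assumes hom: "\<And>q. q \<in> B \<Longrightarrow> homogeneous d q" and "p \<in> ideal_generated B"
  shows "\<exists>s \<in> mpoly3.span B. \<forall>m \<in> Poly_Mapping.keys (p - s). d < total_degree m"
  using assms(2)
proof (induction rule: ideal.span_induct_alt)
  case base
  show ?case by (intro bexI[of _ 0]) (simp_all add: mpoly3.span_zero)
next
  case (step r q y)
  then obtain s where s: "s \<in> mpoly3.span B" "\<forall>m \<in> Poly_Mapping.keys (y - s). d < total_degree m"
    by blast
  define r' where "r' = r - Poly_Mapping.single 0 (Poly_Mapping.lookup r 0)"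
  have "total_degree a > 0" if "a \<in> Poly_Mapping.keys r'" for a
  proof (rule ccontr)
    assume "\<not> ?thesis"
    then have "a = 0" by (intro poly_mapping_eqI) simp
    then show False using that by (simp add: r'_def in_keys_iff lookup_minus)
  qed
  then have r': "\<forall>m \<in> Poly_Mapping.keys (r' * q). d < total_degree m"
    using keys_mult[of r' q] hom[OF step(1)]
    by (fastforce simp: homogeneous_def lookup_add sum.distrib)
  have eq: "(r * q + y) - (mpoly_scale (Poly_Mapping.lookup r 0) q + s) = r' * q + (y - s)"
    by (simp add: r'_def mpoly_scale_def algebra_simps)
  show ?case
  proof (rule bexI[of _ "mpoly_scale (Poly_Mapping.lookup r 0) q + s"])
    show "\<forall>m \<in> Poly_Mapping.keys ((r * q + y) - (mpoly_scale (Poly_Mapping.lookup r 0) q + s)). d < total_degree m"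
      unfolding eq using r' s(2) Poly_Mapping.keys_add[of "r' * q" "y - s"] by blast
    show "mpoly_scale (Poly_Mapping.lookup r 0) q + s \<in> mpoly3.span B"
      by (rule mpoly3.span_add[OF mpoly3.span_scale[OF mpoly3.span_base[OF step(1)]] s(1)])
  qed
qed

text \<open>An element of degree \<open>d\<close> differs from some element of the span only in
  degrees above \<open>d\<close>. Both are homogeneous of degree \<open>d\<close>, so the difference
  is zero. The theorem thereby becomes a question about the linear span of the powers.\<close>

lemma homogeneous_component_ideal:
  fixes B :: "'a::field mpoly3 set"
  assumes hom: "\<And>q. q \<in> B \<Longrightarrow> homogeneous d q"
  shows "homogeneous_component d (ideal_generated B) = mpoly3.span B"
proof (intro equalityI subsetI)
  fix p assume "p \<in> homogeneous_component d (ideal_generated B)"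
  then have p: "p \<in> ideal_generated B" "homogeneous d p"
    by (auto simp: homogeneous_component_def)
  obtain s where s: "s \<in> mpoly3.span B" "\<forall>m \<in> Poly_Mapping.keys (p - s). d < total_degree m"
    using ideal_eq_span_plus_higher[OF hom p(1)] by blast
  have "homogeneous d s" using homogeneous_span[OF hom s(1)] .
  then have "total_degree m = d" if "m \<in> Poly_Mapping.keys (p - s)" for m
    using that p(2) Poly_Mapping.keys_diff[of p s] unfolding homogeneous_def by blast
  then have "Poly_Mapping.keys (p - s) = {}" using s(2) by fastforce
  then have "p = s" by simp
  then show "p \<in> mpoly3.span B" using s(1) by simp
next
  fix p assume p: "p \<in> mpoly3.span B"
  then have "p \<in> ideal_generated B"
  proof (induction rule: mpoly3.span_induct_alt)
    case base
    show ?case by (rule ideal.span_zero)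
  next
    case (step c q y)
    show ?case unfolding mpoly_scale_def
      by (rule ideal.span_add[OF ideal.span_scale[OF ideal.span_base[OF step(1)]] step(2)])
  qed
  then show "p \<in> homogeneous_component d (ideal_generated B)"
    using homogeneous_span[OF hom p] by (simp add: homogeneous_component_def)
qed

section \<open>Powers of combinations of two forms\<close>

lemma mpoly_scale_mult: "mpoly_scale a p * mpoly_scale b q = mpoly_scale (a * b) (p * q)"
proof -
  have "mpoly_scale a p * mpoly_scale b q
      = (Poly_Mapping.single 0 a * Poly_Mapping.single 0 b) * (p * q)"
    unfolding mpoly_scale_def by (simp only: mult_ac)
  then show ?thesis by (simp add: mpoly_scale_def mult_single)
qed

lemma mpoly_scale_power: "mpoly_scale a p ^ n = mpoly_scale (a ^ n) (p ^ n)"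
  by (induction n) (simp_all add: mpoly_scale_mult, simp add: mpoly_scale_def)

lemma binary_power_in_span:
  fixes P Q :: "'a::field mpoly3"
  shows "(mpoly_scale a P + mpoly_scale b Q) ^ d
    \<in> mpoly3.span ((\<lambda>k. P ^ k * Q ^ (d - k)) ` {..d})"
proof -
  let ?B = "(\<lambda>k. P ^ k * Q ^ (d - k)) ` {..d}"
  \<comment> \<open>Binomial coefficients enter as ring elements rather than scalars; multiplying by
    them is repeated addition.\<close>
  have of_nat: "of_nat n * p \<in> mpoly3.span ?B" if "p \<in> mpoly3.span ?B" for n p
    using that by (induction n) (auto simp: algebra_simps intro: mpoly3.span_add mpoly3.span_zero)
  have "mpoly_scale c (P ^ k * Q ^ (d - k)) \<in> mpoly3.span ?B" if "k \<le> d" for c k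
    using that by (intro mpoly3.span_scale mpoly3.span_base) blast
  then show ?thesis
    unfolding binomial_ring mpoly_scale_power mult.assoc mpoly_scale_mult
    by (intro mpoly3.span_sum of_nat) simp
qed

section \<open>Dimension of the span of the powers\<close>

text \<open>All powers belonging to points on the line \<open>b\<close> lie in the span of the
  products with exponents \<open>0\<close> to \<open>d\<close>, which number at most
  \<open>d + 1\<close>; every other point adds at most one generator.\<close>

lemma dim_powers_on_line_le:
  fixes v :: "'b \<Rightarrow> 'a::field ^ 3"
  assumes "finite I" "b \<noteq> 0"
  shows "mpoly_dim ((\<lambda>i. linear_form (v i) ^ d) ` I)
    \<le> d + 1 + card {i \<in> I. dot b (v i) \<noteq> 0}"
proof -
  obtain w1 w2 where w: "\<And>v. dot b v = 0 \<Longrightarrow> \<exists>s t. v = s *s w1 + t *s w2"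
    using orthogonal_two_generators[OF assms(2)] by blast
  define M where "M = (\<lambda>k. linear_form w1 ^ k * linear_form w2 ^ (d - k)) ` {..d}"
  define R where "R = (\<lambda>i. linear_form (v i) ^ d) ` {i \<in> I. dot b (v i) \<noteq> 0}"
  have "linear_form (v i) ^ d \<in> mpoly3.span (M \<union> R)" if "i \<in> I" for i
  proof (cases "dot b (v i) = 0")
    case True
    then obtain s t where "v i = s *s w1 + t *s w2" using w by blast
    then have "linear_form (v i) ^ d \<in> mpoly3.span M"
      unfolding M_def using binary_power_in_span[of s "linear_form w1" t "linear_form w2" d]
      by (simp add: linear_form_add linear_form_scale)
    then show ?thesis using mpoly3.span_mono[of M "M \<union> R"] by blast
  next
    case False
    then show ?thesis using that by (auto simp: R_def intro: mpoly3.span_base)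
  qed
  then have "(\<lambda>i. linear_form (v i) ^ d) ` I \<subseteq> mpoly3.span (M \<union> R)" by blast
  moreover have "finite (M \<union> R)" using assms(1) by (simp add: M_def R_def)
  ultimately have "mpoly_dim ((\<lambda>i. linear_form (v i) ^ d) ` I) \<le> card (M \<union> R)"
    by (rule mpoly3.dim_le_card)
  also have "\<dots> \<le> card M + card R" by (rule card_Un_le)
  also have "card M \<le> d + 1"
    unfolding M_def using card_image_le[of "{..d}"] by (metis card_atMost finite_atMost Suc_eq_plus1)
  also have "card R \<le> card {i \<in> I. dot b (v i) \<noteq> 0}"
    unfolding R_def using assms(1) by (intro card_image_le) simp
  finally show ?thesis by simp
qed

text \<open>The product of the forms in \<open>bs\<close> is nonzero at \<open>v k\<close> and zero
  at the other points, so the polarised relation retains only the term of \<open>k\<close>.\<close>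

lemma powers_relation_trivial:
  fixes v :: "'b \<Rightarrow> 'a::field_char_0 ^ 3"
  assumes "finite I" "card I = 2 * d + 1"
    and indep: "\<And>i j. i \<in> I \<Longrightarrow> j \<in> I \<Longrightarrow> i \<noteq> j \<Longrightarrow> cross (v i) (v j) \<noteq> 0"
    and lines: "\<And>b. b \<noteq> 0 \<Longrightarrow> card {i \<in> I. dot b (v i) = 0} \<le> d + 1"
    and rel: "(\<Sum>i\<in>I. mpoly_scale (c i) (linear_form (v i) ^ d)) = 0"
    and "k \<in> I"
  shows "c k = 0"
proof -
  have through: "card {j \<in> I - {k}. dot b (v j) = 0} \<le> d" if "b \<noteq> 0" "dot b (v k) = 0" for b
  proof -
    \<comment> \<open>The point \<open>v k\<close> itself uses one of the \<open>d + 1\<close>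
      places on the line, leaving at most \<open>d\<close> for the others.\<close>
    have "{i \<in> I. dot b (v i) = 0} = insert k {j \<in> I - {k}. dot b (v j) = 0}"
      using that \<open>k \<in> I\<close> by auto
    then show ?thesis using lines[OF that(1)] \<open>finite I\<close> by simp
  qed
  have card: "card (I - {k}) = 2 * d" using assms(1,2) \<open>k \<in> I\<close> by simp
  have cross: "cross (v k) (v j) \<noteq> 0" if "j \<in> I - {k}" for j
    using indep[OF \<open>k \<in> I\<close>] that by blast
  obtain bs where bs: "length bs = d" "\<And>b. b \<in> set bs \<Longrightarrow> dot b (v k) \<noteq> 0"
    "\<And>j. j \<in> I - {k} \<Longrightarrow> \<exists>b \<in> set bs. dot b (v j) = 0"
    using lines_avoiding_point[of "I - {k}" d "v k" v, OF _ card cross through] \<open>finite I\<close>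
    by (metis finite_Diff)
  \<comment> \<open>Evaluation at \<open>x\<close> turns the relation between polynomials into the
    numerical one required for polarisation.\<close>
  have "(\<Sum>i\<in>I. c i * dot (v i) x ^ length bs) = 0" for x
    using arg_cong[OF rel, of "mpoly3_eval x"]
    by (simp add: mpoly3_eval_sum mpoly3_eval_scale mpoly3_eval_power mpoly3_eval_linear_form bs(1))
  then have "(\<Sum>i\<in>I. c i * (\<Prod>b\<leftarrow>bs. dot b (v i))) = 0"
    by (rule polarise_power_relation)
  moreover have "c i * (\<Prod>b\<leftarrow>bs. dot b (v i)) = 0" if "i \<in> I - {k}" for i
    using bs(3)[OF that] by (auto simp: prod_list_zero_iff)
  ultimately have "c k * (\<Prod>b\<leftarrow>bs. dot b (v k)) = 0"
    using sum.remove[OF \<open>finite I\<close> \<open>k \<in> I\<close>] by (metis (mono_tags, lifting) add.right_neutral sum.neutral)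
  moreover have "(\<Prod>b\<leftarrow>bs. dot b (v k)) \<noteq> 0"
    using bs(2) by (auto simp: prod_list_zero_iff)
  ultimately show ?thesis by simp
qed

lemma dim_powers_eq_card:
  fixes v :: "'b \<Rightarrow> 'a::field_char_0 ^ 3"
  assumes "finite I" "card I = 2 * d + 1"
    and "\<And>i j. i \<in> I \<Longrightarrow> j \<in> I \<Longrightarrow> i \<noteq> j \<Longrightarrow> cross (v i) (v j) \<noteq> 0"
    and "\<And>b. b \<noteq> 0 \<Longrightarrow> card {i \<in> I. dot b (v i) = 0} \<le> d + 1"
  shows "mpoly_dim ((\<lambda>i. linear_form (v i) ^ d) ` I) = 2 * d + 1"
proof -
  let ?f = "\<lambda>i. linear_form (v i) ^ d"
  have inj: "inj_on ?f I"
  proof (rule inj_onI, rule ccontr)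
    fix i j assume ij: "i \<in> I" "j \<in> I" "?f i = ?f j" "i \<noteq> j"
    \<comment> \<open>The dimension concerns the set of powers, so coincidences must be excluded
      first: equal powers would give a relation with coefficients \<open>1\<close> and
      \<open>- 1\<close>.\<close>
    define c where "c k = (if k = i then 1 else if k = j then - 1 else 0 :: 'a)" for k
    have "(\<Sum>k\<in>I. mpoly_scale (c k) (?f k)) = (\<Sum>k\<in>{i, j}. mpoly_scale (c k) (?f k))"
      using ij assms(1) by (intro sum.mono_neutral_right) (auto simp: c_def)
    also have "\<dots> = 0" using ij by (simp add: c_def)
    finally have "c i = 0" using powers_relation_trivial[OF assms] ij(1) by blast
    then show False by (simp add: c_def)
  qed
  \<comment> \<open>Coefficients attached to the powers are pulled back to the indices along the
    injective \<open>?f\<close>.\<close>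
  have "mpoly3.independent (?f ` I)"
    unfolding mpoly3.dependent_finite[OF finite_imageI[OF assms(1)]] sum.reindex[OF inj]
    using powers_relation_trivial[OF assms, where c = "\<lambda>i. _ (?f i)"] by (auto simp: o_def)
  then have "mpoly_dim (?f ` I) = card (?f ` I)"
    by (rule mpoly3.dim_eq_card_independent)
  then show ?thesis using inj assms(2) by (simp add: card_image)
qed

text \<open>For a given line the largest candidate for \<open>S\<close> consists of all the points
  on it. Distinctness of the points makes counting them the same as counting indices.\<close>

lemma aligned_subset_iff:
  fixes v :: "'b \<Rightarrow> 'a::field ^ 3"
  assumes "finite I" "\<And>i. i \<in> I \<Longrightarrow> v i \<noteq> 0" "inj_on (\<lambda>i. proj_point (v i)) I"
  shows "(\<exists>S \<subseteq> (\<lambda>i. proj_point (v i)) ` I. n \<le> card S \<and> aligned S)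
    \<longleftrightarrow> (\<exists>b. b \<noteq> 0 \<and> n \<le> card {i \<in> I. dot b (v i) = 0})" (is "?L \<longleftrightarrow> ?R")
proof
  assume ?L
  then obtain S b where S: "S \<subseteq> (\<lambda>i. proj_point (v i)) ` I" "n \<le> card S"
    "b \<noteq> 0" "S \<subseteq> proj_line b"
    unfolding aligned_def by blast
  have "S \<subseteq> (\<lambda>i. proj_point (v i)) ` {i \<in> I. dot b (v i) = 0}"
    using S(1,4) assms(2) proj_point_in_proj_line_iff by blast
  then have "card S \<le> card {i \<in> I. dot b (v i) = 0}"
    using assms(1) surj_card_le[of "{i \<in> I. dot b (v i) = 0}"] by simp
  then show ?R using S(2,3) order_trans by blast
next
  assume ?R
  then obtain b where b: "b \<noteq> 0" "n \<le> card {i \<in> I. dot b (v i) = 0}" by blast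
  let ?S = "(\<lambda>i. proj_point (v i)) ` {i \<in> I. dot b (v i) = 0}"
  have "card ?S = card {i \<in> I. dot b (v i) = 0}"
    using assms(3) by (intro card_image) (auto elim: inj_on_subset)
  moreover have "aligned ?S"
    unfolding aligned_def using b(1) assms(2) proj_point_in_proj_line_iff by blast
  ultimately show ?L using b(2) by (intro exI[of _ ?S]) auto
qed

theorem theorem21:
  fixes d :: nat
    and l :: "nat \<Rightarrow> 'a::{alg_closed_field, field_char_0} mpoly3"
  assumes "d \<ge> 1"
    and "\<And>i. i \<in> {1..2 * d + 1} \<Longrightarrow> homogeneous 1 (l i) \<and> l i \<noteq> 0"
    and "\<And>i j. i \<in> {1..2 * d + 1} \<Longrightarrow> j \<in> {1..2 * d + 1} \<Longrightarrow> i \<noteq> j \<Longrightarrow>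
           \<not> (\<exists>c. l i = mpoly_scale c (l j))"
  shows "mpoly_dim (homogeneous_component d (ideal_generated ((\<lambda>i. l i ^ d) ` {1..2 * d + 1})))
           < 2 * d + 1
         \<longleftrightarrow> (\<exists>S \<subseteq> (\<lambda>i. dual_point (l i)) ` {1..2 * d + 1}. d + 2 \<le> card S \<and> aligned S)"
proof -
  define I where "I = {1..2 * d + 1}"
  define v where "v i = coeff_vector (l i)" for i
  have I: "finite I" "card I = 2 * d + 1" by (simp_all add: I_def)
  have l: "l i = linear_form (v i)" if "i \<in> I" for i
    using assms(2) that homogeneous_1_eq_linear_form unfolding I_def v_def by blast
  have v0: "v i \<noteq> 0" if "i \<in> I" for i
    using assms(2)[of i] l[OF that] that unfolding I_def by auto
  have not_scale: "v i \<noteq> c *s v j" if "i \<in> I" "j \<in> I" "i \<noteq> j" for i j c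
    using assms(3)[of i j] l[OF that(1)] l[OF that(2)] that
    by (auto simp: I_def linear_form_scale)
  have cross: "cross (v i) (v j) \<noteq> 0" if "i \<in> I" "j \<in> I" "i \<noteq> j" for i j
    using cross_eq_0_imp_scale[OF _ v0[OF that(2)]] not_scale[OF that] by metis
  have inj: "inj_on (\<lambda>i. proj_point (v i)) I"
    using not_scale unfolding inj_on_def proj_point_eq_iff by blast
  have "homogeneous d (q ^ d)" if "homogeneous 1 q" for q :: "'a mpoly3"
    using homogeneous_power[OF that, of d] by simp
  then have "homogeneous_component d (ideal_generated ((\<lambda>i. l i ^ d) ` I))
      = mpoly3.span ((\<lambda>i. l i ^ d) ` I)"
    using assms(2) unfolding I_def by (intro homogeneous_component_ideal) blast
  moreover have "(\<lambda>i. l i ^ d) ` I = (\<lambda>i. linear_form (v i) ^ d) ` I"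
    using l by (intro image_cong) auto
  ultimately have dim: "mpoly_dim (homogeneous_component d (ideal_generated ((\<lambda>i. l i ^ d) ` I)))
      = mpoly_dim ((\<lambda>i. linear_form (v i) ^ d) ` I)" (is "_ = ?dim")
    by (simp add: mpoly3.dim_span)
  have "?dim < 2 * d + 1 \<longleftrightarrow> (\<exists>b. b \<noteq> 0 \<and> d + 2 \<le> card {i \<in> I. dot b (v i) = 0})"
  proof
    assume "?dim < 2 * d + 1"
    then have "\<not> (\<forall>b. b \<noteq> 0 \<longrightarrow> card {i \<in> I. dot b (v i) = 0} \<le> d + 1)"
      using dim_powers_eq_card[where v = v, OF I cross] by fastforce
    then show "\<exists>b. b \<noteq> 0 \<and> d + 2 \<le> card {i \<in> I. dot b (v i) = 0}" by force
  next
    assume "\<exists>b. b \<noteq> 0 \<and> d + 2 \<le> card {i \<in> I. dot b (v i) = 0}"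
    then obtain b where b: "b \<noteq> 0" "d + 2 \<le> card {i \<in> I. dot b (v i) = 0}" by blast
    \<comment> \<open>At least \<open>d + 2\<close> points on the line leave at most
      \<open>d - 1\<close> off it, so the dimension is at most
      \<open>(d + 1) + (d - 1) = 2 * d\<close>.\<close>
    have "card I = card ({i \<in> I. dot b (v i) = 0} \<union> {i \<in> I. dot b (v i) \<noteq> 0})"
      by (rule arg_cong[of _ _ card]) blast
    also have "\<dots> = card {i \<in> I. dot b (v i) = 0} + card {i \<in> I. dot b (v i) \<noteq> 0}"
      using I(1) by (intro card_Un_disjoint) auto
    finally show "?dim < 2 * d + 1"
      using dim_powers_on_line_le[OF I(1) b(1), of v d] b(2) I(2) by linarith
  qed
  moreover have "(\<lambda>i. dual_point (l i)) ` I = (\<lambda>i. proj_point (v i)) ` I"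
    by (simp add: dual_point_def v_def coeff_vector_def)
  ultimately show ?thesis
    using aligned_subset_iff[OF I(1) v0 inj, of "d + 2"] dim unfolding I_def by simp
qed

end
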